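(* Let $S$ be a set of symbols with $|S| = 6$. In the nonrepetitive game over $S$, Ann has a strategy to build an arbitrarily long sequence with no repetitions of size greater than $1$: for every positive integer $n$, Ann has a strategy guaranteeing that, no matter how Ben plays, the sequence of the first $n$ terms contains no repetition of size $h \geq 2$.
   Context: A repetition of size $h$ ($h \geq 1$) in a sequence is a block of consecutive terms of the form $x_1 \dots x_h x_1 \dots x_h$. The nonrepetitive game over a symbol set $S$ is played by two players, Ann (moving first) and Ben, who alternately choose, one by one, consecutive terms $s_1, s_2, s_3, \dots$ of a sequence over $S$ (Ann chooses the odd-indexed terms, Ben the even-indexed ones); nothing is ever erased. Ann tries to avoid repetitions, Ben tries to create them. *)

theory Defs
  imports Main "HOL-Library.Sublist"
begin

definition has_repetition :: "nat \<Rightarrow> 'a list \<Rightarrow> bool" where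
  "has_repetition h w \<longleftrightarrow> h \<ge> 1 \<and> (\<exists>x. length x = h \<and> sublist (x @ x) w)"

text \<open>
  A strategy of Ann sends the list of all terms chosen so far to her next symbol; only its
  values on histories of even length (Ann to move) matter. It must always choose a symbol of
  \<open>S\<close>, so that it can never get stuck.
\<close>

definition ann_strategy :: "'a set \<Rightarrow> ('a list \<Rightarrow> 'a) \<Rightarrow> bool" where
  "ann_strategy S \<sigma> \<longleftrightarrow> (\<forall>w\<in>lists S. even (length w) \<longrightarrow> \<sigma> w \<in> S)"

text \<open>
  The finite sequences that can arise when Ann follows \<open>\<sigma>\<close> and Ben plays arbitrary symbols of
  \<open>S\<close>. List positions start at 0, so Ann owns the even positions (the terms
  \<open>s\<^sub>1, s\<^sub>3, \<dots>\<close>).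
\<close>

definition consistent_play :: "'a set \<Rightarrow> ('a list \<Rightarrow> 'a) \<Rightarrow> 'a list \<Rightarrow> bool" where
  "consistent_play S \<sigma> w \<longleftrightarrow>
     w \<in> lists S \<and> (\<forall>i<length w. even i \<longrightarrow> w ! i = \<sigma> (take i w))"

end

theory Submission imports Defs begin

text \<open>
  The game with a fixed number of rounds is finite, so if Ann had no winning strategy, Ben would
  have a fixed reply to every history. Against such replies a play is determined by the choices of
  Ann. Let \<open>V k\<close> be the set of plays of \<open>k\<close> rounds without a repetition of size at least 2. If one
  more round completes a repetition of size \<open>2j\<close> or \<open>2j + 1\<close>, then the last \<open>j\<close> choices of Ann are
  copies of terms of the first \<open>k + 1 - j\<close> rounds; so each of these two sizes spoils at most
  \<open>|V (k + 1 - j)|\<close> plays, whether the repetition ends with Ann's or with Ben's term. Hence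
  \<open>|V (k + 1)| \<ge> 6 |V k| - 2 (|V 0| + \<dots> + |V k|)\<close>, and \<open>|V (k + 1)| \<ge> 2 |V k|\<close> follows by
  induction, since \<open>1 + 1/2 + 1/4 + \<dots> = 2\<close>. So the number of good plays never drops to 0.
\<close>

definition repetition_free :: "'a list \<Rightarrow> bool" where
  "repetition_free w \<longleftrightarrow> (\<forall>h\<ge>2. \<not> has_repetition h w)"

lemma repetition_free_Nil: "repetition_free []"
  by (auto simp: repetition_free_def has_repetition_def)

lemma repetition_free_prefix:
  assumes "repetition_free w" "prefix v w"
  shows "repetition_free v"
  using assms unfolding repetition_free_def has_repetition_def
  by (metis prefix_imp_sublist sublist_order.order_trans)

subsection \<open>Counting plays against fixed replies\<close>

text \<open>The replies \<open>ben\<close> are arbitrary and need not lie in \<open>S\<close>, so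
  the count also covers replies picked by \<open>SOME\<close>.\<close>

definition plays :: "'a set \<Rightarrow> ('a list \<Rightarrow> 'a \<Rightarrow> 'a) \<Rightarrow> nat \<Rightarrow> 'a list set" where
  "plays S ben k = {w. length w = 2 * k \<and>
     (\<forall>i<k. w ! (2 * i) \<in> S \<and> w ! (2 * i + 1) = ben (take (2 * i) w) (w ! (2 * i)))}"

definition good_plays :: "'a set \<Rightarrow> ('a list \<Rightarrow> 'a \<Rightarrow> 'a) \<Rightarrow> nat \<Rightarrow> 'a list set" where
  "good_plays S ben k = {w \<in> plays S ben k. repetition_free w}"

lemma plays_0: "plays S ben 0 = {[]}"
  by (auto simp: plays_def)

lemma length_plays: "w \<in> plays S ben k \<Longrightarrow> length w = 2 * k"
  by (simp add: plays_def)

lemma take_plays: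
  assumes "w \<in> plays S ben k" "m \<le> k"
  shows "take (2 * m) w \<in> plays S ben m"
  using assms by (auto simp: plays_def min_def)

lemma take_good_plays:
  assumes "w \<in> good_plays S ben k" "m \<le> k"
  shows "take (2 * m) w \<in> good_plays S ben m"
  using assms take_plays repetition_free_prefix take_is_prefix
  unfolding good_plays_def by blast

lemma plays_Suc:
  "plays S ben (Suc k) = (\<lambda>(w, a). w @ [a, ben w a]) ` (plays S ben k \<times> S)"
proof (intro equalityI subsetI)
  fix w assume w: "w \<in> plays S ben (Suc k)"
  let ?u = "take (2 * k) w"
  have len: "length w = Suc (Suc (2 * k))" using length_plays[OF w] by simp
  have "w = ?u @ [w ! (2 * k), w ! (2 * k + 1)]"
    using len by (metis Suc_eq_plus1 append.assoc append_Cons append_Nil lessI less_SucI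
        order.refl take_Suc_conv_app_nth take_all)
  moreover have "w ! (2 * k) \<in> S" "w ! (2 * k + 1) = ben ?u (w ! (2 * k))"
    using w by (auto simp: plays_def)
  moreover have "?u \<in> plays S ben k" using take_plays[OF w, of k] by simp
  ultimately show "w \<in> (\<lambda>(w, a). w @ [a, ben w a]) ` (plays S ben k \<times> S)"
    by (intro image_eqI[where x = "(?u, w ! (2 * k))"]) auto
next
  fix w assume "w \<in> (\<lambda>(w, a). w @ [a, ben w a]) ` (plays S ben k \<times> S)"
  then show "w \<in> plays S ben (Suc k)"
    by (auto simp: plays_def nth_append less_Suc_eq)
qed

lemma finite_plays:
  assumes "finite S"
  shows "finite (plays S ben k)"
  by (induction k) (use assms in \<open>auto simp: plays_0 plays_Suc\<close>)

text \<open>Each term of Ben is a function of what precedes it, so Ann's choices determine the play,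
  round by round.\<close>

lemma plays_eqI:
  assumes "v \<in> plays S ben k" "w \<in> plays S ben k"
    and "take (2 * m) v = take (2 * m) w"
    and "\<And>i. m \<le> i \<Longrightarrow> i < k \<Longrightarrow> v ! (2 * i) = w ! (2 * i)"
  shows "v = w"
proof -
  have eq: "v ! (2 * i) = w ! (2 * i)" if "i < k" for i
    using assms(3,4) that by (metis mult_less_mono2 not_less nth_take zero_less_numeral)
  have "take (2 * i) v = take (2 * i) w" if "i \<le> k" for i
    using that
  proof (induction i)
    case (Suc i)
    have "take (2 * Suc i) u = take (2 * i) u @ [u ! (2 * i), ben (take (2 * i) u) (u ! (2 * i))]"
      if "u \<in> plays S ben k" for u
      using that Suc.prems by (simp add: plays_def take_Suc_conv_app_nth)
    with Suc eq[of i] assms(1,2) show ?case by simp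
  qed simp
  from this[of k] show ?thesis using assms(1,2) by (simp add: length_plays)
qed

definition extensions :: "'a set \<Rightarrow> ('a list \<Rightarrow> 'a \<Rightarrow> 'a) \<Rightarrow> nat \<Rightarrow> 'a list set" where
  "extensions S ben k = {w \<in> plays S ben (Suc k). take (2 * k) w \<in> good_plays S ben k}"

lemma card_extensions: "card (extensions S ben k) = card (good_plays S ben k) * card S"
proof -
  have "extensions S ben k = (\<lambda>(w, a). w @ [a, ben w a]) ` (good_plays S ben k \<times> S)"
    by (fastforce simp: extensions_def plays_Suc good_plays_def length_plays)
  moreover have "inj_on (\<lambda>(w, a). w @ [a, ben w a]) (good_plays S ben k \<times> S)"
    by (auto simp: inj_on_def)
  ultimately show ?thesis by (simp add: card_image card_cartesian_product)
qed

text \<open>Used with \<open>m = Suc k - j\<close> and \<open>h = 2 * j\<close> or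
  \<open>2 * j + 1\<close>: of a repetition of size \<open>h\<close>, only its effect on Ann's last
  \<open>j\<close> terms is kept. The clause \<open>h \<le> 2 * i\<close> rules out truncated
  subtraction.\<close>

definition pinned :: "'a set \<Rightarrow> ('a list \<Rightarrow> 'a \<Rightarrow> 'a) \<Rightarrow> nat \<Rightarrow> nat \<Rightarrow> nat \<Rightarrow> 'a list set" where
  "pinned S ben k m h = {w \<in> extensions S ben k.
     \<forall>i. m \<le> i \<and> i \<le> k \<longrightarrow> h \<le> 2 * i \<and> w ! (2 * i) = w ! (2 * i - h)}"

text \<open>The copied positions \<open>2 * i - h\<close> lie below \<open>2 * m\<close>, so the
  first \<open>m\<close> rounds fix all later choices of Ann and truncating to them is
  injective.\<close>

lemma card_pinned:
  assumes "finite S" "m \<le> k" "2 * (Suc k - m) \<le> h"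
  shows "card (pinned S ben k m h) \<le> card (good_plays S ben m)"
proof (rule card_inj_on_le[where f = "take (2 * m)"])
  show "inj_on (take (2 * m)) (pinned S ben k m h)"
  proof (rule inj_onI)
    fix v w
    assume v: "v \<in> pinned S ben k m h" and w: "w \<in> pinned S ben k m h"
      and eq: "take (2 * m) v = take (2 * m) w"
    show "v = w"
    proof (rule plays_eqI[OF _ _ eq])
      fix i assume i: "m \<le> i" "i < Suc k"
      then have "h \<le> 2 * i" using v by (simp add: pinned_def)
      then have "2 * i - h < 2 * m" using i assms(2,3) by linarith
      then have "v ! (2 * i - h) = w ! (2 * i - h)" using eq by (metis nth_take)
      then show "v ! (2 * i) = w ! (2 * i)" using v w i by (simp add: pinned_def)
    qed (use v w in \<open>auto simp: pinned_def extensions_def\<close>)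
  qed
  show "take (2 * m) ` pinned S ben k m h \<subseteq> good_plays S ben m"
  proof (rule image_subsetI)
    fix w assume "w \<in> pinned S ben k m h"
    then have "take (2 * k) w \<in> good_plays S ben k"
      by (simp add: pinned_def extensions_def)
    from take_good_plays[OF this assms(2)] show "take (2 * m) w \<in> good_plays S ben m"
      using assms(2) by (simp add: min_def)
  qed
  show "finite (good_plays S ben m)"
    using finite_plays[OF assms(1)] by (simp add: good_plays_def)
qed

text \<open>The first \<open>k\<close> rounds are good, so a repetition must end in the last round,
  with either player's term. Its second half then covers Ann's last \<open>j\<close> terms, where
  \<open>j\<close> is half its size rounded down.\<close>

lemma extensions_subset:
  "extensions S ben k \<subseteq> good_plays S ben (Suc k) \<union>
     (\<Union>m\<le>k. pinned S ben k m (2 * (Suc k - m)) \<union> pinned S ben k m (2 * (Suc k - m) + 1))"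
proof
  fix w assume w: "w \<in> extensions S ben k"
  show "w \<in> good_plays S ben (Suc k) \<union>
     (\<Union>m\<le>k. pinned S ben k m (2 * (Suc k - m)) \<union> pinned S ben k m (2 * (Suc k - m) + 1))"
  proof (cases "repetition_free w")
    case True
    then show ?thesis using w by (simp add: good_plays_def extensions_def)
  next
    case False
    then obtain x u v where x: "length x \<ge> 2" and wx: "w = u @ (x @ x) @ v"
      unfolding repetition_free_def has_repetition_def sublist_def by metis
    let ?h = "length x"
    define j where "j = ?h div 2"
    have len: "length u + 2 * ?h + length v = 2 * k + 2"
      using w wx length_plays[of w S ben "Suc k"] by (simp add: extensions_def)
    \<comment> \<open>Otherwise \<open>x @ x\<close> would lie within the first \<open>k\<close>
      rounds.\<close>
    have v: "length v \<le> 1"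
    proof (rule ccontr)
      assume "\<not> length v \<le> 1"
      then have "take (2 * k) w = u @ (x @ x) @ take (2 * k - length u - 2 * ?h) v"
        using len by (simp add: wx mult_2 diff_diff_left add.assoc)
      then have "sublist (x @ x) (take (2 * k) w)"
        unfolding sublist_def by blast
      then show False using w x
        by (auto simp: extensions_def good_plays_def repetition_free_def has_repetition_def)
    qed
    \<comment> \<open>Size at least 2 enters here: a repetition of size 1 gives \<open>j = 0\<close>
      and pins no term of Ann.\<close>
    have j: "1 \<le> j" "j \<le> k" "?h = 2 * j \<or> ?h = 2 * j + 1"
      using x len unfolding j_def by linarith+
    have "w \<in> pinned S ben k (Suc k - j) ?h"
      unfolding pinned_def
    proof (intro CollectI conjI allI impI w)
      fix i assume i: "Suc k - j \<le> i \<and> i \<le> k"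
      have lo: "length u + ?h \<le> 2 * i" using i len j v by linarith
      have hi: "2 * i < length u + 2 * ?h" using i len j v by linarith
      show "?h \<le> 2 * i" using lo by simp
      \<comment> \<open>The offset of position \<open>2 * i\<close> within the second copy of
        \<open>x\<close>.\<close>
      define d where "d = 2 * i - length u - ?h"
      have d: "2 * i = length u + (?h + d)" "2 * i - ?h = length u + d" "d < ?h"
        using lo hi unfolding d_def by linarith+
      have "w ! (length u + (?h + d)) = x ! d" "w ! (length u + d) = x ! d"
        using d(3) by (simp_all add: wx nth_append)
      then show "w ! (2 * i) = w ! (2 * i - ?h)" using d by simp
    qed
    moreover have "Suc k - (Suc k - j) = j" using j by simp
    ultimately have "w \<in> pinned S ben k (Suc k - j) (2 * (Suc k - (Suc k - j))) \<union>
        pinned S ben k (Suc k - j) (2 * (Suc k - (Suc k - j)) + 1)"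
      using j(3) by (elim disjE) simp_all
    moreover have "Suc k - j \<in> {..k}" using j by simp
    ultimately show ?thesis by blast
  qed
qed

text \<open>Union bound over the bad extensions; the factor 2 counts the even and the odd size
  belonging to each \<open>m\<close>.\<close>

lemma card_good_plays_Suc:
  assumes "finite S"
  shows "card S * card (good_plays S ben k)
           \<le> card (good_plays S ben (Suc k)) + 2 * (\<Sum>m\<le>k. card (good_plays S ben m))"
proof -
  let ?P = "\<lambda>m. pinned S ben k m (2 * (Suc k - m)) \<union> pinned S ben k m (2 * (Suc k - m) + 1)"
  have fin: "finite (good_plays S ben (Suc k))" "finite (?P m)" for m
    using finite_plays[OF assms] by (simp_all add: good_plays_def pinned_def extensions_def)
  have P: "card (?P m) \<le> 2 * card (good_plays S ben m)" if "m \<le> k" for m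
    using card_pinned[OF assms that, of "2 * (Suc k - m)" ben]
      card_pinned[OF assms that, of "2 * (Suc k - m) + 1" ben]
    by (intro order_trans[OF card_Un_le]) simp
  have "card (extensions S ben k) \<le> card (good_plays S ben (Suc k) \<union> (\<Union>m\<le>k. ?P m))"
    by (rule card_mono[OF _ extensions_subset]) (use fin in auto)
  also have "\<dots> \<le> card (good_plays S ben (Suc k)) + card (\<Union>m\<le>k. ?P m)"
    by (rule card_Un_le)
  also have "card (\<Union>m\<le>k. ?P m) \<le> (\<Sum>m\<le>k. card (?P m))"
    by (rule card_UN_le) simp
  also have "\<dots> \<le> (\<Sum>m\<le>k. 2 * card (good_plays S ben m))"
    using P by (intro sum_mono) simp
  finally show ?thesis by (simp add: card_extensions mult.commute sum_distrib_left)
qed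

lemma good_plays_nonempty:
  assumes "card S = 6"
  shows "good_plays S ben k \<noteq> {}"
proof -
  let ?v = "\<lambda>k. card (good_plays S ben k)"
  have "finite S" using assms card.infinite by fastforce
  note step = card_good_plays_Suc[OF this, of ben, unfolded assms]
  \<comment> \<open>This invariant replaces the geometric series: with it \<open>step\<close> gives
    \<open>6 * ?v k \<le> ?v (Suc k) + 4 * ?v k\<close>, so the count at least doubles, which
    restores the invariant.\<close>
  have "(\<Sum>m\<le>k. ?v m) \<le> 2 * ?v k \<and> ?v k > 0" for k
  proof (induction k)
    case 0
    have "good_plays S ben 0 = {[]}"
      using repetition_free_Nil by (auto simp: good_plays_def plays_0)
    then show ?case by simp
  next
    case (Suc k)
    then show ?case using step[of k] by simp
  qed
  then show ?thesis by (metis card.empty less_irrefl)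
qed

subsection \<open>Backward induction\<close>

text \<open>Testing only the final sequence suffices, since nothing is erased and a repetition
  persists.\<close>

fun ann_wins :: "'a set \<Rightarrow> nat \<Rightarrow> 'a list \<Rightarrow> bool" where
  "ann_wins S 0 w \<longleftrightarrow> repetition_free w"
| "ann_wins S (Suc k) w \<longleftrightarrow> (\<exists>a\<in>S. \<forall>b\<in>S. ann_wins S k (w @ [a, b]))"

lemma ann_wins_Nil:
  assumes "card S = 6"
  shows "ann_wins S K []"
proof (rule ccontr)
  assume lost: "\<not> ann_wins S K []"
  \<comment> \<open>Ben moves to a lost position for Ann whenever one exists;
    \<open>length w div 2\<close> counts the completed rounds.\<close>
  define ben where "ben w a = (SOME b. b \<in> S \<and> \<not> ann_wins S (K - Suc (length w div 2)) (w @ [a, b]))"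
    for w a
  have "\<not> ann_wins S (K - k) w" if "k \<le> K" "w \<in> plays S ben k" for k w
    using that
  proof (induction k arbitrary: w)
    case 0
    then show ?case using lost by (simp add: plays_0)
  next
    case (Suc k)
    then obtain u a where u: "u \<in> plays S ben k" "a \<in> S" "w = u @ [a, ben u a]"
      by (auto simp: plays_Suc)
    have "K - k = Suc (K - Suc k)" using Suc.prems(1) by simp
    with Suc.IH[OF _ u(1)] Suc.prems(1) u(2)
    have "\<exists>b. b \<in> S \<and> \<not> ann_wins S (K - Suc k) (u @ [a, b])" by auto
    from someI_ex[OF this] show ?case
      using length_plays[OF u(1)] by (simp add: u(3) ben_def)
  qed
  from this[of K] have "good_plays S ben K = {}"
    by (auto simp: good_plays_def)
  with good_plays_nonempty[OF assms] show False by blast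
qed

text \<open>Choosing a winning move each time preserves the winning property. The second conjunct
  covers a round in which Ben has not yet replied, as needed for odd lengths.\<close>

lemma ann_wins_imp_strategy:
  assumes "S \<noteq> {}" "ann_wins S K []"
  shows "\<exists>\<sigma>. ann_strategy S \<sigma> \<and> (\<forall>w k. consistent_play S \<sigma> w \<longrightarrow> 2 * k \<le> length w \<longrightarrow> k \<le> K \<longrightarrow>
           ann_wins S (K - k) (take (2 * k) w) \<and>
           (k < K \<longrightarrow> (\<forall>b\<in>S. ann_wins S (K - Suc k) (take (2 * k) w @ [\<sigma> (take (2 * k) w), b]))))"
proof -
  define win where "win w a \<longleftrightarrow> a \<in> S \<and> (\<forall>b\<in>S. ann_wins S (K - Suc (length w div 2)) (w @ [a, b]))"
    for w a
  \<comment> \<open>The default keeps \<open>\<sigma>\<close> inside \<open>S\<close> on histories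
    without a winning move.\<close>
  define \<sigma> where "\<sigma> w = (if \<exists>a. win w a then SOME a. win w a else SOME a. a \<in> S)" for w
  have win: "win w (\<sigma> w)" if "win w a" for w a
    using that unfolding \<sigma>_def by (auto intro: someI)
  have "\<sigma> w \<in> S" for w
  proof (cases "\<exists>a. win w a")
    case True
    then show ?thesis using win by (auto simp: win_def)
  next
    case False
    then show ?thesis using assms(1) by (simp add: \<sigma>_def some_in_eq)
  qed
  then have "ann_strategy S \<sigma>" by (simp add: ann_strategy_def)
  moreover have next_move: "\<forall>b\<in>S. ann_wins S (K - Suc k) (u @ [\<sigma> u, b])"
    if "ann_wins S (K - k) u" "length u = 2 * k" "k < K" for k u
  proof -
    have "K - k = Suc (K - Suc k)" using that(3) by simp
    then have "\<exists>a. win u a" using that(1,2) by (auto simp: win_def)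
    then have "win u (\<sigma> u)" using win by blast
    then show ?thesis using that(2) by (simp add: win_def)
  qed
  moreover have "ann_wins S (K - k) (take (2 * k) w)"
    if "consistent_play S \<sigma> w" "2 * k \<le> length w" "k \<le> K" for w k
    using that(2,3)
  proof (induction k)
    case 0
    then show ?case using assms(2) by simp
  next
    case (Suc k)
    let ?u = "take (2 * k) w"
    have "w ! (2 * k) = \<sigma> ?u" "w ! (2 * k + 1) \<in> S"
      using that(1) Suc.prems by (auto simp: consistent_play_def)
    moreover from this have "take (2 * Suc k) w = ?u @ [\<sigma> ?u, w ! (2 * k + 1)]"
      using Suc.prems by (simp add: take_Suc_conv_app_nth)
    ultimately show ?case using next_move[of k ?u] Suc by simp
  qed
  ultimately show ?thesis by (intro exI[of _ \<sigma>]) auto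
qed

theorem theorem2:
  fixes S :: "'a set"
  assumes "card S = 6"
  shows "\<forall>n\<ge>1. \<exists>\<sigma>. ann_strategy S \<sigma> \<and>
           (\<forall>w. consistent_play S \<sigma> w \<and> length w = n \<longrightarrow> (\<forall>h\<ge>2. \<not> has_repetition h w))"
proof (intro allI impI)
  fix n :: nat
  \<comment> \<open>Rounded up, so that for odd \<open>n\<close> the sequence stops in the middle of
    the last round.\<close>
  define K where "K = (n + 1) div 2"
  have S: "S \<noteq> {}" using assms by auto
  obtain \<sigma> where \<sigma>: "ann_strategy S \<sigma>"
    and wins: "\<And>w k. consistent_play S \<sigma> w \<Longrightarrow> 2 * k \<le> length w \<Longrightarrow> k \<le> K \<Longrightarrow>
           ann_wins S (K - k) (take (2 * k) w) \<and>
           (k < K \<longrightarrow> (\<forall>b\<in>S. ann_wins S (K - Suc k) (take (2 * k) w @ [\<sigma> (take (2 * k) w), b])))"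
    using ann_wins_imp_strategy[OF S ann_wins_Nil[OF assms]] by metis
  have "repetition_free w" if w: "consistent_play S \<sigma> w" "length w = n" for w
  proof (cases "even n")
    case True
    then show ?thesis using wins[OF w(1), of K] w(2) by (auto simp: K_def)
  next
    case False
    then obtain k where k: "n = Suc (2 * k)" by (auto elim: oddE)
    then have K: "K = Suc k" by (simp add: K_def)
    \<comment> \<open>Any reply will do: it completes the last round, and freedom from repetitions
      passes back to the prefix \<open>w\<close>.\<close>
    obtain b where b: "b \<in> S" using S by blast
    have "w = take (2 * k) w @ [w ! (2 * k)]"
      using w(2) k by (metis lessI order.refl take_Suc_conv_app_nth take_all)
    moreover have "w ! (2 * k) = \<sigma> (take (2 * k) w)"
      using w k by (simp add: consistent_play_def)
    moreover have "repetition_free (take (2 * k) w @ [\<sigma> (take (2 * k) w), b])"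
      using wins[OF w(1), of k] w(2) k K b by simp
    ultimately show ?thesis
      by (metis append.assoc append_Cons append_Nil prefixI repetition_free_prefix)
  qed
  then show "\<exists>\<sigma>. ann_strategy S \<sigma> \<and>
      (\<forall>w. consistent_play S \<sigma> w \<and> length w = n \<longrightarrow> (\<forall>h\<ge>2. \<not> has_repetition h w))"
    using \<sigma> unfolding repetition_free_def by blast
qed

end
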